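(* Let $q=p^e>4$, where $p$ is a prime, and let $\ell$ be a positive integer with $2\ell\mid e$. Let $n=t\frac{q-1}{p^\ell-1}$ with $1\le t\le p^\ell-1$, and let $s\ge1$. Then, for every integer $k$ with $s<k\le\left\lfloor\frac{p^\ell+n+1}{p^\ell+1}\right\rfloor$ and every integer $h$ with $0\le h\le k-s$, there exists an $[n+s+1,k]_q$ generalized Roth-Lempel code $C$ (with $n+1$ evaluation points and an $s\times s$ extension matrix) such that $\dim\bigl(\operatorname{Hull}_{\ell}(C)\bigr)=h$.
   Context: For $q=p^e$ and $0\le\ell\le e-1$, the $\ell$-Galois inner product on $\mathbb F_q^M$ is $\langle\boldsymbol x,\boldsymbol y\rangle_\ell=\sum_i x_iy_i^{p^\ell}$. For a linear code $C\subseteq\mathbb F_q^M$, $C^{\perp_\ell}=\{\boldsymbol x\in\mathbb F_q^M:\langle\boldsymbol c,\boldsymbol x\rangle_\ell=0\ \text{for all }\boldsymbol c\in C\}$ and $\operatorname{Hull}_\ell(C)=C\cap C^{\perp_\ell}$. A generalized Roth-Lempel (GRL) code with $N$ evaluation points and extension matrix of size $s$, where $1\le s\le k\le N$, is an $[N+s,k]_q$ code of the form $$\operatorname{GRL}_k(\boldsymbol a,\boldsymbol v,A_s)=\{(v_1f(a_1),\ldots,v_Nf(a_N),(f_{k-s},\ldots,f_{k-1})A_s): f(x)=\textstyle\sum_{j=0}^{k-1}f_jx^j\in\mathbb F_q[x]\},$$ where $\boldsymbol a\in\mathbb F_q^N$ has pairwise distinct entries (the evaluation points), $\boldsymbol v\in(\mathbb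 F_q^* )^N$ and $A_s\in\operatorname{GL}_s(\mathbb F_q)$. *)

theory Defs
  imports
    "Jordan_Normal_Form.VS_Connect"
    "HOL-Computational_Algebra.Polynomial"
    "HOL-Computational_Algebra.Primes"
    "HOL-Library.Cardinality"
begin

(* A length-M code over the field 'a is a set of vectors in carrier_vec M. *)

definition code_dim :: "nat \<Rightarrow> 'a::field vec set \<Rightarrow> nat" where
  "code_dim M C = vectorspace.dim class_ring ((module_vec TYPE('a) M)\<lparr>carrier := C\<rparr>)"

definition linear_code :: "nat \<Rightarrow> nat \<Rightarrow> 'a::field vec set \<Rightarrow> bool" where
  "linear_code M k C \<longleftrightarrow>
     subspace class_ring C (module_vec TYPE('a) M) \<and> code_dim M C = k"

(* The prime p is the characteristic of 'a. *)
definition galois_inner :: "nat \<Rightarrow> nat \<Rightarrow> 'a::field vec \<Rightarrow> 'a vec \<Rightarrow> 'a" where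
  "galois_inner p l x y = (\<Sum>i<dim_vec x. x $ i * (y $ i) ^ (p ^ l))"

definition galois_dual :: "nat \<Rightarrow> nat \<Rightarrow> nat \<Rightarrow> 'a::field vec set \<Rightarrow> 'a vec set" where
  "galois_dual M p l C = {x \<in> carrier_vec M. \<forall>c\<in>C. galois_inner p l c x = 0}"

definition galois_hull :: "nat \<Rightarrow> nat \<Rightarrow> nat \<Rightarrow> 'a::field vec set \<Rightarrow> 'a vec set" where
  "galois_hull M p l C = C \<inter> galois_dual M p l C"

(* The row vector (f_(k-s), ..., f_(k-1)) times A is written as the transpose of A
   applied to that vector. *)
definition grl_codeword ::
  "nat \<Rightarrow> nat \<Rightarrow> nat \<Rightarrow> 'a::field vec \<Rightarrow> 'a vec \<Rightarrow> 'a mat \<Rightarrow> 'a poly \<Rightarrow> 'a vec" where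
  "grl_codeword N s k a v A f =
     vec N (\<lambda>i. v $ i * poly f (a $ i)) @\<^sub>v
     (transpose_mat A *\<^sub>v vec s (\<lambda>j. coeff f (k - s + j)))"

(* For k > 0, which is_GRL_code guarantees, degree f < k says that f has the form
   f_0 + ... + f_(k-1) x^(k-1); the zero polynomial has degree 0 and is included. *)
definition grl_code ::
  "nat \<Rightarrow> nat \<Rightarrow> nat \<Rightarrow> 'a::field vec \<Rightarrow> 'a vec \<Rightarrow> 'a mat \<Rightarrow> 'a vec set" where
  "grl_code N s k a v A = {grl_codeword N s k a v A f | f. degree f < k}"

definition is_GRL_code :: "nat \<Rightarrow> nat \<Rightarrow> nat \<Rightarrow> 'a::field vec set \<Rightarrow> bool" where
  "is_GRL_code N s k C \<longleftrightarrow>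
     1 \<le> s \<and> s \<le> k \<and> k \<le> N \<and> linear_code (N + s) k C \<and>
     (\<exists>a v A. a \<in> carrier_vec N \<and> inj_on (\<lambda>i. a $ i) {..<N} \<and>
        v \<in> carrier_vec N \<and> (\<forall>i<N. v $ i \<noteq> 0) \<and>
        A \<in> carrier_mat s s \<and> invertible_mat A \<and>
        C = grl_code N s k a v A)"

end

(* Put Q = p^l. If the weights of a generalized Reed-Solomon code satisfy v_a^(Q+1) = 1 / prod_(b <> a) (a - b),
   then the Galois form of the codewords of f and g is, up to the extension part, the x^n coefficient of
   f g^Q, which by the bound on k involves only the leading coefficients. With a scalar extension matrix the
   form then has rank exactly s on the code. Rescaling r = k - s - h of the weights by an element omega with
   omega^(Q+1) <> 1 adds r independent rank-one terms, and the hull becomes the set of codewords of polynomials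
   of degree < k - s vanishing at the r corresponding points, which has dimension h. *)

theory Submission
  imports Defs
begin

section \<open>Power maps on finite fields\<close>

text \<open>Multiplication by \<open>x\<close> permutes the nonzero elements, so their product is
  unchanged when each factor is multiplied by \<open>x\<close>.\<close>

lemma finite_field_power_card_minus_one:
  fixes x :: "'a::{field,finite}"
  assumes "x \<noteq> 0"
  shows "x ^ (CARD('a) - 1) = 1"
proof -
  have "(\<Prod>y\<in>UNIV-{0}. x * y) = (\<Prod>y\<in>UNIV-{0}. y)"
    by (rule prod.reindex_bij_witness[of _ "\<lambda>y. y / x" "\<lambda>y. x * y"]) (use assms in auto)
  moreover have "(\<Prod>y\<in>UNIV-{0::'a}. x * y) = x ^ (CARD('a) - 1) * (\<Prod>y\<in>UNIV-{0}. y)"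
    by (simp add: prod.distrib)
  ultimately show ?thesis
    by (simp add: prod_zero_iff)
qed

lemma card_power_fibre_le:
  fixes c :: "'a::idom"
  assumes "d > 0"
  shows "card {x. x ^ d = c} \<le> d"
proof -
  have "degree (monom 1 d - [:c:]) \<le> d"
    by (intro degree_diff_le) (auto simp: degree_monom_le)
  moreover have "coeff (monom 1 d - [:c:]) d = 1"
    using assms by (cases d) auto
  hence "monom 1 d - [:c:] \<noteq> 0"
    by (metis coeff_0 zero_neq_one)
  moreover have "{x. x ^ d = c} = {x. poly (monom 1 d - [:c:]) x = 0}"
    by (simp add: poly_monom)
  ultimately show ?thesis
    using card_poly_roots_bound[of "monom 1 d - [:c:]"] by simp
qed

text \<open>All \<open>q - 1\<close> nonzero elements are roots of \<open>x\<^sup>q\<^sup>-\<^sup>1 - 1 = (x\<^sup>d - c) H(x)\<close>, and \<open>H\<close> accounts for at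
  most \<open>q - 1 - d\<close> of them.\<close>

lemma card_power_fibre:
  fixes c :: "'a::{field,finite}"
  assumes dd: "d * d' = CARD('a) - 1" and c: "c ^ d' = 1"
  shows "card {x. x ^ d = c} = d"
proof -
  have "CARD('a) \<ge> 2"
    using card_mono[of UNIV "{0, 1::'a}"] by simp
  hence pos: "d > 0" "d' > 0"
    using dd by (auto intro!: Nat.gr0I)
  define P :: "'a poly" where "P = monom 1 (d * d') - 1"
  define F where "F = monom 1 d - [:c:]"
  \<comment> \<open>Since \<open>c ^ d' = 1\<close>, \<open>P\<close> is a difference of
    \<open>d'\<close>-th powers and hence divisible by \<open>F\<close>.\<close>
  have "(monom 1 d) ^ d' - [:c:] ^ d' = P"
    using c by (simp add: P_def monom_power poly_const_pow one_pCons)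
  then obtain H where H: "P = F * H"
    unfolding F_def by (metis power_diff_sumr2)
  have degF: "degree F = d"
  proof (rule antisym)
    show "degree F \<le> d"
      unfolding F_def by (intro degree_diff_le) (auto simp: degree_monom_le)
    show "d \<le> degree F"
      unfolding F_def using pos by (intro le_degree) (cases d, auto)
  qed
  have degP: "degree P = d * d'"
  proof (rule antisym)
    show "degree P \<le> d * d'"
      unfolding P_def by (intro degree_diff_le) (auto simp: degree_monom_le)
    show "d * d' \<le> degree P"
      unfolding P_def using pos by (intro le_degree) (simp add: coeff_1)
  qed
  have "P \<noteq> 0"
    using degP pos by auto
  hence nz: "F \<noteq> 0" "H \<noteq> 0"
    using H by auto
  have degH: "d + degree H = d * d'"
    using degP degF degree_mult_eq[OF nz] by (simp add: H)
  have "UNIV - {0} \<subseteq> {x. x ^ d = c} \<union> {x. poly H x = 0}"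
  proof
    fix x :: 'a assume "x \<in> UNIV - {0}"
    hence "poly P x = 0"
      using finite_field_power_card_minus_one[of x] by (simp add: P_def poly_monom dd)
    thus "x \<in> {x. x ^ d = c} \<union> {x. poly H x = 0}"
      by (auto simp: H F_def poly_monom)
  qed
  hence "card (UNIV - {0::'a}) \<le> card ({x. x ^ d = c} \<union> {x. poly H x = 0})"
    by (intro card_mono) auto
  also have "\<dots> \<le> card {x. x ^ d = c} + degree H"
    by (intro order.trans[OF card_Un_le] add_left_mono card_poly_roots_bound nz)
  finally have "d \<le> card {x. x ^ d = c}"
    using degH dd by simp
  thus ?thesis
    using card_power_fibre_le[OF pos(1), of c] by simp
qed

text \<open>Translation by 1 permutes the field, so summing all elements shows that the field order
  is zero in the field. The characteristic is therefore a prime divisor of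
  \<open>p ^ e\<close>.\<close>

lemma CHAR_eq_of_CARD_prime_power:
  assumes "prime p" and "CARD('a::{field,finite}) = p ^ e"
  shows "CHAR('a) = p"
proof -
  have "prime CHAR('a)"
    by (intro prime_CHAR_semidom finite_imp_CHAR_pos) auto
  moreover have "CHAR('a) dvd p ^ e"
  proof -
    have "(\<Sum>x\<in>UNIV. x + 1 :: 'a) = (\<Sum>x\<in>UNIV. x)"
      by (rule sum.reindex_bij_witness[of _ "\<lambda>x. x - 1" "\<lambda>x. x + 1"]) auto
    hence "of_nat CARD('a) = (0 :: 'a)"
      by (simp add: sum.distrib)
    thus ?thesis
      unfolding assms(2) of_nat_eq_0_iff_char_dvd .
  qed
  ultimately show ?thesis
    using assms(1) prime_dvd_power primes_dvd_imp_eq by blast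
qed

text \<open>A fibre of the power map has at most \<open>d\<close> elements, too few to cover all
  nonzero ones. This supplies the two scalars that keep the Galois form nondegenerate where it has
  to be.\<close>

lemma exists_nonzero_power_neq:
  fixes c :: "'a::{field,finite}"
  assumes "d > 0" "d < CARD('a) - 1"
  obtains x where "x \<noteq> 0" "x ^ d \<noteq> c"
proof -
  have "card {x. x ^ d = c} < card (UNIV - {0::'a})"
    using card_power_fibre_le[OF assms(1), of c] assms(2) by simp
  hence "\<not> UNIV - {0} \<subseteq> {x. x ^ d = c}"
    using card_mono[of "{x. x ^ d = c}" "UNIV - {0}"] by auto
  thus ?thesis
    using that by auto
qed

section \<open>Lagrange weights\<close>

text \<open>Lagrange interpolation at \<open>S\<close> is exact below degree \<open>card S\<close>.
  Each basis numerator \<open>G x\<close> is monic of degree \<open>card S - 1\<close>, so comparing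
  coefficients in that degree gives the sum.\<close>

lemma sum_Lagrange_weights_eq_coeff:
  fixes f :: "'a::field poly"
  assumes fin: "finite S" and deg: "degree f < card S"
  shows "(\<Sum>x\<in>S. poly f x / (\<Prod>b\<in>S-{x}. x - b)) = coeff f (card S - 1)"
proof -
  define w where "w x = (\<Prod>b\<in>S-{x}. x - b)" for x
  define G where "G x = (\<Prod>b\<in>S-{x}. [:-b, 1:])" for x
  have w_nz: "w x \<noteq> 0" for x
    unfolding w_def using fin by (simp add: prod_zero_iff)
  have degG: "degree (G x) = card S - 1" and leadG: "coeff (G x) (card S - 1) = 1" if "x \<in> S" for x
  proof -
    show "degree (G x) = card S - 1"
      unfolding G_def using that fin by (subst degree_prod_eq_sum_degree) (auto simp: card_Diff_singleton)
    moreover have "lead_coeff (G x) = 1"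
      unfolding G_def by (simp add: lead_coeff_prod)
    ultimately show "coeff (G x) (card S - 1) = 1" by simp
  qed
  have polyG: "poly (G x) y = (if x = y then w y else 0)" if "x \<in> S" "y \<in> S" for x y
    using that fin by (auto simp: G_def w_def poly_prod prod_zero_iff)
  have "f = (\<Sum>x\<in>S. Polynomial.smult (poly f x / w x) (G x))"
  proof (rule poly_eqI_degree[where A = S])
    fix y assume y: "y \<in> S"
    have "poly (\<Sum>x\<in>S. Polynomial.smult (poly f x / w x) (G x)) y = (\<Sum>x\<in>S. if x = y then poly f y else 0)"
      unfolding poly_sum using w_nz y by (intro sum.cong) (auto simp: polyG)
    thus "poly f y = poly (\<Sum>x\<in>S. Polynomial.smult (poly f x / w x) (G x)) y"
      using y fin by simp
  next
    show "degree f < card S" by fact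
    have "degree (\<Sum>x\<in>S. Polynomial.smult (poly f x / w x) (G x)) \<le> card S - 1"
      using fin degG by (intro degree_sum_le) (auto intro: order.trans[OF degree_smult_le])
    thus "degree (\<Sum>x\<in>S. Polynomial.smult (poly f x / w x) (G x)) < card S"
      using deg by linarith
  qed
  hence "coeff f (card S - 1) = (\<Sum>x\<in>S. coeff (Polynomial.smult (poly f x / w x) (G x)) (card S - 1))"
    by (metis coeff_sum)
  also have "\<dots> = (\<Sum>x\<in>S. poly f x / w x)"
    using leadG by (intro sum.cong) auto
  finally show ?thesis by (simp add: w_def)
qed

text \<open>The \<open>Q\<close>-power map is additive and permutes \<open>S\<close>, so it turns
  the product into one over the differences of \<open>z * a\<close> with the other points. As
  \<open>S\<close> is also stable under multiplication by \<open>z\<close>, these differences are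
  \<open>z * (a - b)\<close>, and the resulting power of \<open>z\<close> is 1.\<close>

lemma prod_diff_power_eq_self:
  fixes S :: "'a::idom set"
  assumes char: "prime CHAR('a)" "Q = CHAR('a) ^ l" and fin: "finite S"
    and powS: "\<And>x. x \<in> S \<Longrightarrow> x ^ Q \<in> S"
    and a: "a \<in> S" and z: "a ^ Q = z * a" "z \<noteq> 0" "\<And>x. x \<in> S \<Longrightarrow> z * x \<in> S"
    and z1: "z ^ (card S - 1) = 1"
  shows "(\<Prod>b\<in>S-{a}. a - b) ^ Q = (\<Prod>b\<in>S-{a}. a - b)"
proof -
  have diff: "(x - y) ^ Q = x ^ Q - y ^ Q" for x y :: 'a
    using freshmans_dream'[OF char, of "x - y" y] by simp
  have inj: "inj_on (\<lambda>x. x ^ Q) S"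
    by (intro inj_onI) (metis diff eq_iff_diff_eq_0 power_eq_0_iff)
  have frob: "(\<lambda>x. x ^ Q) ` S = S"
    using powS inj fin by (intro endo_inj_surj) auto
  have mult: "(*) z ` S = S"
    using z fin by (intro endo_inj_surj) (auto intro!: inj_onI)
  have "(\<Prod>b\<in>S-{a}. a - b) ^ Q = (\<Prod>b\<in>S-{a}. a ^ Q - b ^ Q)"
    unfolding prod_power_distrib by (intro prod.cong) (simp_all add: diff)
  also have "\<dots> = (\<Prod>b\<in>(\<lambda>x. x ^ Q) ` (S-{a}). a ^ Q - b)"
    using inj by (subst prod.reindex) (auto intro: inj_on_subset)
  also have "(\<lambda>x. x ^ Q) ` (S-{a}) = S - {z * a}"
    using frob inj a z(1) by (subst inj_on_image_set_diff[OF inj]) auto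
  also have "S - {z * a} = (*) z ` (S-{a})"
    using mult a z(2) by (subst image_set_diff) (auto intro!: injI)
  also have "(\<Prod>b\<in>(*) z ` (S-{a}). a ^ Q - b) = (\<Prod>b\<in>S-{a}. z * (a - b))"
    using z by (subst prod.reindex) (auto intro!: inj_onI simp: algebra_simps)
  also have "\<dots> = (\<Prod>b\<in>S-{a}. a - b)"
    using z1 a fin by (simp add: prod.distrib card_Diff_singleton)
  finally show ?thesis .
qed

text \<open>The points are \<open>0\<close> and \<open>t\<close> cosets of the kernel of the norm map onto the subfield of order \<open>Q\<close>. Both
  the \<open>Q\<close>-Frobenius and multiplication by \<open>a\<^sup>Q\<^sup>-\<^sup>1\<close> permute them, so that the Lagrange weights lie in the
  subfield, all of whose elements are \<open>(Q + 1)\<close>-st powers.\<close>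

lemma exists_points_with_power_weights:
  assumes char: "prime CHAR('a::{field,finite})" "Q = CHAR('a) ^ l" and Q: "Q \<ge> 2"
    and q: "CARD('a) - 1 = (Q - 1) * ((Q + 1) * K)" and t: "t \<le> Q - 1"
  obtains S :: "'a::{field,finite} set" and \<nu> where "card S = t * ((Q + 1) * K) + 1"
    and "\<And>a. a \<in> S \<Longrightarrow> \<nu> a ^ (Q + 1) = 1 / (\<Prod>b\<in>S-{a}. a - b)"
proof -
  define m where "m = (Q + 1) * K"
  have dd: "(Q - 1) * m = CARD('a) - 1" "m * (Q - 1) = CARD('a) - 1" "(Q + 1) * ((Q - 1) * K) = CARD('a) - 1"
    by (simp_all only: m_def q mult_ac)
  have m: "m > 0"
    using dd(1) card_mono[of UNIV "{0, 1::'a}"] by (auto intro!: Nat.gr0I)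
  have "card {x::'a. x ^ (Q - 1) = 1} = Q - 1"
    by (rule card_power_fibre[OF dd(1)]) simp
  then obtain B :: "'a set" where B: "B \<subseteq> {x. x ^ (Q - 1) = 1}" "card B = t"
    using t obtain_subset_with_card_n by metis
  \<comment> \<open>Each of the \<open>t\<close> values in \<open>B\<close> has exactly
    \<open>m\<close> preimages under the \<open>m\<close>-th power map.\<close>
  define S' where "S' = {x. x ^ m \<in> B}"
  define S where "S = insert 0 S'"
  have "card S' = card (\<Union>\<beta>\<in>B. {x. x ^ m = \<beta>})"
    by (rule arg_cong[of _ _ card]) (auto simp: S'_def)
  also have "\<dots> = (\<Sum>\<beta>\<in>B. card {x. x ^ m = \<beta>})"
    by (rule card_UN_disjoint) auto
  also have "\<dots> = (\<Sum>\<beta>\<in>B. m)"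
    using B by (intro sum.cong card_power_fibre[OF dd(2)]) auto
  finally have cardS': "card S' = t * m"
    using B by simp
  have z0: "0 \<notin> S'"
    using B m Q by (auto simp: S'_def power_0_left)
  have cardS: "card S = t * m + 1"
    using cardS' z0 by (simp add: S_def)
  have pow_Q: "x ^ Q = x ^ (Q - 1) * x" for x :: 'a
    using Q by (metis One_nat_def Suc_diff_1 less_le_trans pos2 power_Suc2)
  have "\<exists>y. y ^ (Q + 1) = 1 / (\<Prod>b\<in>S-{a}. a - b)" if a: "a \<in> S" for a
  proof -
    define D where "D = (\<Prod>b\<in>S-{a}. a - b)"
    \<comment> \<open>Forced by \<open>a ^ Q = z * a\<close> when \<open>a\<close> is nonzero; for
      \<open>a = 0\<close> the value 1 keeps \<open>z\<close> nonzero. In both cases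
      \<open>z ^ m = 1\<close>, so multiplication by \<open>z\<close> does not change
      \<open>x ^ m\<close>.\<close>
    define z where "z = (if a = 0 then 1 else a ^ (Q - 1))"
    have zm: "z ^ m = 1"
      using finite_field_power_card_minus_one[of a] by (simp add: z_def dd(1)[unfolded One_nat_def] flip: power_mult)
    have "D ^ Q = D"
      unfolding D_def
    proof (rule prod_diff_power_eq_self[OF char _ _ a])
      show "a ^ Q = z * a" "z \<noteq> 0"
        using Q by (auto simp: z_def pow_Q)
      show "z * x \<in> S" if "x \<in> S" for x
        using that zm by (auto simp: S_def S'_def power_mult_distrib)
      have "z ^ (card S - 1) = (z ^ m) ^ t"
        by (simp add: cardS mult.commute flip: power_mult)
      thus "z ^ (card S - 1) = 1"
        using zm by simp
      show "x ^ Q \<in> S" if "x \<in> S" for x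
      proof (cases "x = 0")
        case False
        hence x: "x ^ m \<in> B"
          using that by (auto simp: S_def S'_def)
        have "(x ^ Q) ^ m = (x ^ m) ^ Q"
          by (simp add: mult.commute flip: power_mult)
        also have "\<dots> = x ^ m"
          using x B by (subst pow_Q) auto
        finally show ?thesis
          using x by (simp add: S_def S'_def)
      qed (use Q in \<open>simp add: S_def power_0_left\<close>)
    qed simp
    moreover have "D \<noteq> 0"
      by (simp add: D_def prod_zero_iff)
    \<comment> \<open>The exponents \<open>Q + 1\<close> and \<open>(Q - 1) * K\<close> multiply to
      the order of the multiplicative group, so this makes \<open>1 / D\<close> a
      \<open>(Q + 1)\<close>-st power.\<close>
    ultimately have "D ^ (Q - 1) = 1"
      using pow_Q[of D] by simp
    hence "(1 / D) ^ ((Q - 1) * K) = 1"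
      by (simp add: power_mult power_one_over)
    hence "card {y. y ^ (Q + 1) = 1 / D} = Q + 1"
      by (rule card_power_fibre[OF dd(3)])
    hence "{y. y ^ (Q + 1) = 1 / D} \<noteq> {}"
      by force
    thus ?thesis
      by (auto simp: D_def)
  qed
  then obtain \<nu> where "\<And>a. a \<in> S \<Longrightarrow> \<nu> a ^ (Q + 1) = 1 / (\<Prod>b\<in>S-{a}. a - b)"
    by metis
  thus ?thesis
    using that[of S \<nu>] cardS by (simp add: m_def)
qed

section \<open>Generalized Roth-Lempel codes\<close>

text \<open>An injective linear map is an isomorphism onto its image, so the dimension carries over
  from the full space of length \<open>d\<close>.\<close>

lemma linear_code_linear_image:
  fixes T :: "'a::field vec \<Rightarrow> 'a vec"
  assumes carr: "\<And>c. c \<in> carrier_vec d \<Longrightarrow> T c \<in> carrier_vec M"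
    and add: "\<And>c c'. c \<in> carrier_vec d \<Longrightarrow> c' \<in> carrier_vec d \<Longrightarrow> T (c + c') = T c + T c'"
    and smult: "\<And>r c. c \<in> carrier_vec d \<Longrightarrow> T (r \<cdot>\<^sub>v c) = r \<cdot>\<^sub>v T c"
    and inj: "inj_on T (carrier_vec d)"
  shows "linear_code M d (T ` carrier_vec d)"
proof -
  interpret V: vec_space "TYPE('a)" d .
  interpret W: vec_space "TYPE('a)" M .
  define U where "U = T ` carrier_vec d"
  have zero: "T (0\<^sub>v d) = 0\<^sub>v M"
    using smult[of "0\<^sub>v d" 0] carr[of "0\<^sub>v d"] by auto
  have U: "subspace class_ring U W.V"
  proof (intro subspace.intro LinearCombinations.submodule.intro W.vectorspace_axioms W.module_axioms)
    show "U \<subseteq> carrier W.V"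
      using carr by (auto simp: U_def module_vec_simps)
    show "\<zero>\<^bsub>W.V\<^esub> \<in> U"
      unfolding U_def module_vec_simps using zero by (intro image_eqI[where x = "0\<^sub>v d"]) auto
  next
    fix x y assume "x \<in> U" "y \<in> U"
    then obtain c c' where c: "c \<in> carrier_vec d" "c' \<in> carrier_vec d" "x = T c" "y = T c'"
      by (auto simp: U_def)
    show "x \<oplus>\<^bsub>W.V\<^esub> y \<in> U"
      unfolding U_def module_vec_simps using c add by (intro image_eqI[where x = "c + c'"]) auto
  next
    fix r x assume "x \<in> U"
    then obtain c where c: "c \<in> carrier_vec d" "x = T c"
      by (auto simp: U_def)
    show "r \<odot>\<^bsub>W.V\<^esub> x \<in> U"
      unfolding U_def module_vec_simps using c smult by (intro image_eqI[where x = "r \<cdot>\<^sub>v c"]) auto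
  qed
  have vsU: "vectorspace class_ring (W.vs U)"
    by (rule W.subspace_is_vs[OF U])
  interpret L: linear_map class_ring V.V "W.vs U" T
  proof (intro linear_map.intro mod_hom.intro mod_hom_axioms.intro)
    show "vectorspace class_ring V.V" by (rule V.vectorspace_axioms)
    show "vectorspace class_ring (W.vs U)" by fact
    show "module class_ring V.V" by (rule V.module_axioms)
    show "module class_ring (W.vs U)" using vsU by (rule vectorspace.axioms)
    show "T \<in> LinearCombinations.module_hom class_ring V.V (W.vs U)"
      using add smult by (auto simp: LinearCombinations.module_hom_def U_def module_vec_simps)
  qed
  have "V.dim = vectorspace.dim class_ring (W.vs U)"
    by (rule L.dim_eq) (use inj in \<open>auto simp: U_def module_vec_simps\<close>)
  thus ?thesis
    using U by (simp add: linear_code_def code_dim_def U_def V.dim_is_n)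
qed

section \<open>Coefficient vectors, polynomials and codewords\<close>

lemma coeff_Poly_list_of_vec:
  "coeff (Poly (list_of_vec c)) i = (if i < dim_vec c then c $ i else 0)"
  by (simp add: nth_default_def list_of_vec_index)

lemma degree_Poly_list_of_vec_less:
  assumes "c \<in> carrier_vec d" "d > 0"
  shows "degree (Poly (list_of_vec c)) < d"
  using assms by (intro degree_lessI) (auto simp: coeff_Poly_list_of_vec simp del: coeff_Poly_eq)

text \<open>The disjunct \<open>g = 0\<close> matters for \<open>d = 0\<close>: only the zero
  polynomial remains, although no degree is below 0.\<close>

lemma Poly_list_of_vec_image:
  "(\<lambda>c. Poly (list_of_vec c)) ` carrier_vec d = {g :: 'a::comm_ring_1 poly. g = 0 \<or> degree g < d}"
proof (intro equalityI subsetI)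
  fix g :: "'a poly" assume "g \<in> {g. g = 0 \<or> degree g < d}"
  hence "g = Poly (list_of_vec (vec d (coeff g)))"
    by (intro poly_eqI) (auto simp: coeff_Poly_list_of_vec coeff_eq_0 simp del: coeff_Poly_eq list_of_vec_vec)
  thus "g \<in> (\<lambda>c. Poly (list_of_vec c)) ` carrier_vec d"
    by (intro image_eqI[where x = "vec d (coeff g)"]) auto
next
  fix g :: "'a poly" assume "g \<in> (\<lambda>c. Poly (list_of_vec c)) ` carrier_vec d"
  then obtain c where c: "c \<in> carrier_vec d" "g = Poly (list_of_vec c)"
    by blast
  show "g \<in> {g. g = 0 \<or> degree g < d}"
  proof (cases "d = 0")
    case True
    thus ?thesis
      using c by (auto intro!: poly_eqI simp: coeff_Poly_list_of_vec simp del: coeff_Poly_eq)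
  qed (use c degree_Poly_list_of_vec_less in auto)
qed

lemma grl_codeword_carrier:
  "A \<in> carrier_mat s s \<Longrightarrow> grl_codeword N s k a v A f \<in> carrier_vec (N + s)"
  by (auto simp: grl_codeword_def)

lemma dim_grl_codeword:
  "A \<in> carrier_mat s s \<Longrightarrow> dim_vec (grl_codeword N s k a v A f) = N + s"
  by (rule carrier_vecD[OF grl_codeword_carrier])

lemma grl_codeword_index:
  assumes "A \<in> carrier_mat s s"
  shows "i < N \<Longrightarrow> grl_codeword N s k a v A f $ i = v $ i * poly f (a $ i)"
    and "j < s \<Longrightarrow> grl_codeword N s k a v A f $ (N + j) = (\<Sum>i<s. A $$ (i, j) * coeff f (k - s + i))"
  using assms by (auto simp: grl_codeword_def scalar_prod_def lessThan_atLeast0)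

lemma grl_codeword_add:
  assumes "A \<in> carrier_mat s s"
  shows "grl_codeword N s k a v A (f + g) = grl_codeword N s k a v A f + grl_codeword N s k a v A g"
proof (rule eq_vecI)
  fix i assume "i < dim_vec (grl_codeword N s k a v A f + grl_codeword N s k a v A g)"
  hence "i < N + s"
    using assms by (simp add: grl_codeword_def)
  then consider "i < N" | j where "i = N + j" "j < s"
    by (metis add_less_cancel_left less_imp_add_positive not_less_iff_gr_or_eq add_0_right)
  thus "grl_codeword N s k a v A (f + g) $ i
      = (grl_codeword N s k a v A f + grl_codeword N s k a v A g) $ i"
    by cases (use assms in \<open>simp_all add: dim_grl_codeword grl_codeword_index[OF assms] ring_distribs
        mult.left_commute sum.distrib\<close>)
qed (use assms in \<open>simp add: grl_codeword_def\<close>)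

lemma grl_codeword_smult:
  assumes "A \<in> carrier_mat s s"
  shows "grl_codeword N s k a v A (Polynomial.smult r f) = r \<cdot>\<^sub>v grl_codeword N s k a v A f"
proof (rule eq_vecI)
  fix i assume "i < dim_vec (r \<cdot>\<^sub>v grl_codeword N s k a v A f)"
  hence "i < N + s"
    using assms by (simp add: grl_codeword_def)
  then consider "i < N" | j where "i = N + j" "j < s"
    by (metis add_less_cancel_left less_imp_add_positive not_less_iff_gr_or_eq add_0_right)
  thus "grl_codeword N s k a v A (Polynomial.smult r f) $ i = (r \<cdot>\<^sub>v grl_codeword N s k a v A f) $ i"
    by cases (use assms in \<open>simp_all add: dim_grl_codeword grl_codeword_index[OF assms] ring_distribs
        mult.left_commute sum_distrib_left\<close>)
qed (use assms in \<open>simp add: grl_codeword_def\<close>)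

text \<open>Equal codewords give equal values at \<open>N\<close> distinct points, and
  \<open>N\<close> is at least \<open>k\<close>, above both degrees.\<close>

lemma inj_on_grl_codeword:
  fixes a v :: "'a::field vec"
  assumes A: "A \<in> carrier_mat s s" and "k \<le> N"
    and inj: "inj_on (\<lambda>i. a $ i) {..<N}" and v: "\<forall>i<N. v $ i \<noteq> 0"
  shows "inj_on (grl_codeword N s k a v A) {f. degree f < k}"
proof (rule inj_onI)
  fix f g assume fg: "f \<in> {f. degree f < k}" "g \<in> {f. degree f < k}"
    and eq: "grl_codeword N s k a v A f = grl_codeword N s k a v A g"
  show "f = g"
  proof (rule poly_eqI_degree[where A = "(\<lambda>i. a $ i) ` {..<N}"])
    fix x assume "x \<in> (\<lambda>i. a $ i) ` {..<N}"
    then obtain i where i: "i < N" "x = a $ i" by auto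
    have "v $ i * poly f (a $ i) = v $ i * poly g (a $ i)"
      using eq grl_codeword_index(1)[OF A i(1)] by metis
    thus "poly f x = poly g x"
      using v i by simp
  qed (use fg \<open>k \<le> N\<close> in \<open>auto simp: card_image[OF inj]\<close>)
qed

text \<open>The multiples of \<open>P\<close> are parametrised by the coefficient vector of the
  cofactor. With \<open>P = 1\<close> this gives the whole code; with \<open>P\<close> a product of
  linear factors it gives the hull.\<close>

lemma linear_code_grl_multiples:
  fixes a v :: "'a::field vec"
  assumes A: "A \<in> carrier_mat s s" and "k \<le> N"
    and inj: "inj_on (\<lambda>i. a $ i) {..<N}" and v: "\<forall>i<N. v $ i \<noteq> 0"
    and P: "P \<noteq> 0" and deg: "degree P + d \<le> k"
  shows "linear_code (N + s) d
    (grl_codeword N s k a v A ` {g. P dvd g \<and> (g = 0 \<or> degree g < degree P + d)})"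
proof -
  let ?poly = "\<lambda>c::'a vec. Poly (list_of_vec c)"
  define T where "T c = grl_codeword N s k a v A (P * ?poly c)" for c
  have deg_mult: "g = 0 \<or> degree g < d \<longleftrightarrow> P * g = 0 \<or> degree (P * g) < degree P + d" for g
    using P by (cases "g = 0") (auto simp: degree_mult_eq)
  have "T ` carrier_vec d = grl_codeword N s k a v A ` (\<lambda>g. P * g) ` (?poly ` carrier_vec d)"
    by (simp add: T_def image_image)
  also have "(\<lambda>g. P * g) ` (?poly ` carrier_vec d)
      = {g. P dvd g \<and> (g = 0 \<or> degree g < degree P + d)}"
    unfolding Poly_list_of_vec_image deg_mult by (auto simp: dvd_def)
  finally have im: "T ` carrier_vec d
    = grl_codeword N s k a v A ` {g. P dvd g \<and> (g = 0 \<or> degree g < degree P + d)}" .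
  have "linear_code (N + s) d (T ` carrier_vec d)"
  proof (rule linear_code_linear_image)
    show "T c \<in> carrier_vec (N + s)" for c
      by (simp add: T_def grl_codeword_carrier[OF A])
  next
    fix c c' :: "'a vec" assume "c \<in> carrier_vec d" "c' \<in> carrier_vec d"
    hence "?poly (c + c') = ?poly c + ?poly c'"
      by (intro poly_eqI) (auto simp: coeff_Poly_list_of_vec simp del: coeff_Poly_eq)
    thus "T (c + c') = T c + T c'"
      by (simp add: T_def ring_distribs grl_codeword_add[OF A])
  next
    fix r and c :: "'a vec" assume "c \<in> carrier_vec d"
    have "?poly (r \<cdot>\<^sub>v c) = Polynomial.smult r (?poly c)"
      by (intro poly_eqI) (auto simp: coeff_Poly_list_of_vec simp del: coeff_Poly_eq)
    thus "T (r \<cdot>\<^sub>v c) = r \<cdot>\<^sub>v T c"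
      by (simp add: T_def grl_codeword_smult[OF A])
  next
    show "inj_on T (carrier_vec d)"
    proof (rule inj_onI)
      fix c c' :: "'a vec" assume c: "c \<in> carrier_vec d" "c' \<in> carrier_vec d" and eq: "T c = T c'"
      show "c = c'"
      \<comment> \<open>For \<open>d = 0\<close> there is only the empty vector; the strict degree
        bound on cofactors requires \<open>d > 0\<close>.\<close>
      proof (cases "d = 0")
        case False
        have "degree (P * ?poly b) < k" if "b \<in> carrier_vec d" for b
          using degree_mult_le[of P "?poly b"] degree_Poly_list_of_vec_less[OF that] False deg by linarith
        hence "P * ?poly c = P * ?poly c'"
          using inj_onD[OF inj_on_grl_codeword[OF assms(1-4)], of "P * ?poly c" "P * ?poly c'"] eq c
          by (simp add: T_def)
        hence eq': "?poly c = ?poly c'"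
          using P by simp
        show ?thesis
        proof (rule eq_vecI)
          fix i assume "i < dim_vec c'"
          thus "c $ i = c' $ i"
            using coeff_Poly_list_of_vec[of c i] coeff_Poly_list_of_vec[of c' i] eq' c by simp
        qed (use c in simp)
      qed (use c in auto)
    qed
  qed
  thus ?thesis by (simp add: im)
qed

section \<open>The Galois form and the hull of a generalized Roth-Lempel code\<close>

lemma sum_lessThan_add:
  fixes f :: "nat \<Rightarrow> 'b::comm_monoid_add"
  shows "(\<Sum>i<m + n. f i) = (\<Sum>i<m. f i) + (\<Sum>j<n. f (m + j))"
  by (induction n) (simp_all add: add.assoc)

text \<open>A scalar extension matrix makes the extension part diagonal in the top \<open>s\<close>
  coefficients.\<close>

lemma galois_inner_grl_codeword_scalar:
  assumes A: "A = \<alpha> \<cdot>\<^sub>m 1\<^sub>m s"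
  shows "galois_inner p l (grl_codeword N s k a v A f) (grl_codeword N s k a v A g)
    = (\<Sum>i<N. (v $ i) ^ (p ^ l + 1) * (poly f (a $ i) * poly g (a $ i) ^ (p ^ l)))
      + (\<Sum>j<s. \<alpha> ^ (p ^ l + 1) * (coeff f (k - s + j) * coeff g (k - s + j) ^ (p ^ l)))"
proof -
  have carr: "A \<in> carrier_mat s s"
    by (simp add: A)
  have ext: "grl_codeword N s k a v A f $ (N + j) = \<alpha> * coeff f (k - s + j)" if "j < s" for f j
  proof -
    have "grl_codeword N s k a v A f $ (N + j)
        = (\<Sum>i<s. if i = j then \<alpha> * coeff f (k - s + j) else 0)"
      unfolding grl_codeword_index(2)[OF carr that] using that by (intro sum.cong) (auto simp: A)
    thus ?thesis using that by simp
  qed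
  have "dim_vec (grl_codeword N s k a v A f) = N + s"
    using dim_grl_codeword[OF carr] by auto
  thus ?thesis
    unfolding galois_inner_def
    by (simp add: sum_lessThan_add grl_codeword_index(1)[OF carr] ext power_mult_distrib mult_ac)
qed

text \<open>After the last root is split off, the cofactor still vanishes at the others because the
  points are distinct.\<close>

lemma prod_linear_dvd_iff:
  fixes x :: "nat \<Rightarrow> 'a::field"
  assumes "inj_on x {..<r}"
  shows "(\<Prod>i<r. [:- x i, 1:]) dvd g \<longleftrightarrow> (\<forall>i<r. poly g (x i) = 0)"
  using assms
proof (induction r arbitrary: g)
  case (Suc r)
  have inj: "inj_on x {..<r}"
    using Suc.prems by (rule inj_on_subset) auto
  show ?case
  proof
    assume "(\<Prod>i<Suc r. [:- x i, 1:]) dvd g"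
    moreover have "[:- x i, 1:] dvd (\<Prod>i<Suc r. [:- x i, 1:])" if "i < Suc r" for i
      using that by (intro dvd_prodI) auto
    ultimately show "\<forall>i<Suc r. poly g (x i) = 0"
      unfolding poly_eq_0_iff_dvd by (blast intro: dvd_trans)
  next
    assume zero: "\<forall>i<Suc r. poly g (x i) = 0"
    then obtain h where h: "g = [:- x r, 1:] * h"
      by (auto simp: poly_eq_0_iff_dvd dvd_def)
    have "poly h (x i) = 0" if "i < r" for i
    proof -
      have "x i \<noteq> x r"
        using Suc.prems that by (auto simp: inj_on_def)
      thus ?thesis
        using zero[rule_format, of i] that by (simp add: h)
    qed
    hence "(\<Prod>i<r. [:- x i, 1:]) dvd h"
      using Suc.IH[OF inj] by blast
    thus "(\<Prod>i<Suc r. [:- x i, 1:]) dvd g"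
      unfolding h prod.lessThan_Suc mult.commute[of "[:- x r, 1:]"] by (rule mult_dvd_mono) simp
  qed
qed simp

text \<open>The hypothesis \<open>form\<close> says that the Galois form has a Gram matrix of rank \<open>r + s\<close> diagonalised by \<open>r\<close>
  evaluations and the top \<open>s\<close> coefficients. Testing against the polynomials vanishing at all but one of
  the \<open>r\<close> points, of degree below \<open>k - s\<close>, isolates each evaluation.\<close>

lemma galois_hull_grl_code:
  fixes a v :: "'a::field vec"
  assumes A: "A \<in> carrier_mat s s" and inj: "inj_on (\<lambda>i. a $ i) {..<r}"
    and k: "s < k" "r \<le> k - s" and p: "p > 0"
    and nz: "\<And>i. i < r \<Longrightarrow> \<gamma> i \<noteq> 0" "\<And>j. j < s \<Longrightarrow> \<beta> j \<noteq> 0"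
    and form: "\<And>f g. degree f < k \<Longrightarrow> degree g < k \<Longrightarrow>
      galois_inner p l (grl_codeword N s k a v A f) (grl_codeword N s k a v A g)
      = (\<Sum>i<r. \<gamma> i * (poly f (a $ i) * poly g (a $ i) ^ (p ^ l)))
        + (\<Sum>j<s. \<beta> j * (coeff f (k - s + j) * coeff g (k - s + j) ^ (p ^ l)))"
  shows "galois_hull (N + s) p l (grl_code N s k a v A)
    = grl_codeword N s k a v A `
        {g. (\<Prod>i<r. [:- (a $ i), 1:]) dvd g \<and> (g = 0 \<or> degree g < k - s)}"
proof -
  let ?cw = "grl_codeword N s k a v A"
  let ?I = "\<lambda>f g. galois_inner p l (?cw f) (?cw g)"
  have radical: "(\<forall>f. degree f < k \<longrightarrow> ?I f g = 0)
      \<longleftrightarrow> (\<forall>i<r. poly g (a $ i) = 0) \<and> (g = 0 \<or> degree g < k - s)" if g: "degree g < k" for g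
  proof (intro iffI conjI allI impI)
    assume orth: "\<forall>f. degree f < k \<longrightarrow> ?I f g = 0"
    show van: "poly g (a $ i) = 0" if i: "i < r" for i
    proof -
      define f where "f = (\<Prod>i'\<in>{..<r}-{i}. [:- (a $ i'), 1:])"
      have deg: "degree f < k - s"
        using i k by (auto simp: f_def degree_prod_eq_sum_degree)
      have f0: "poly f (a $ i') = 0" if "i' < r" "i' \<noteq> i" for i'
        using that by (auto simp: f_def poly_prod prod_zero_iff intro!: bexI[of _ i'])
      have f1: "poly f (a $ i) \<noteq> 0"
        using inj i by (auto simp: f_def poly_prod prod_zero_iff inj_on_def)
      have "?I f g = (\<Sum>i'<r. \<gamma> i' * (poly f (a $ i') * poly g (a $ i') ^ (p ^ l)))"
        using deg k g by (subst form) (auto simp: coeff_eq_0)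
      also have "\<dots> = (\<Sum>i'<r. if i' = i then \<gamma> i * (poly f (a $ i) * poly g (a $ i) ^ (p ^ l)) else 0)"
        using f0 by (intro sum.cong) auto
      finally have "?I f g = \<gamma> i * (poly f (a $ i) * poly g (a $ i) ^ (p ^ l))"
        using i by simp
      thus ?thesis
        using orth deg f1 nz(1)[OF i] by (auto simp: less_diff_conv)
    qed
    have top: "coeff g (k - s + j) = 0" if j: "j < s" for j
    proof -
      \<comment> \<open>Since the evaluations of \<open>g\<close> already vanish, testing against
        this monomial isolates one top coefficient of \<open>g\<close>.\<close>
      define f :: "'a poly" where "f = monom 1 (k - s + j)"
      have deg: "degree f < k"
        using j k by (simp add: f_def degree_monom_eq)
      have "?I f g = (\<Sum>j'<s. \<beta> j' * (coeff f (k - s + j') * coeff g (k - s + j') ^ (p ^ l)))"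
        using deg g van p by (subst form) (auto simp: power_0_left)
      also have "\<dots> = (\<Sum>j'<s. if j' = j then \<beta> j * coeff g (k - s + j) ^ (p ^ l) else 0)"
        by (intro sum.cong) (auto simp: f_def)
      finally have "?I f g = (\<Sum>j'<s. if j' = j then \<beta> j * coeff g (k - s + j) ^ (p ^ l) else 0)" .
      thus ?thesis
        using orth deg nz(2)[OF j] j by simp
    qed
    have "degree g < k - s"
    proof (rule degree_lessI)
      show "\<forall>i\<ge>k - s. coeff g i = 0"
      proof (intro allI impI)
        fix i assume "i \<ge> k - s"
        thus "coeff g i = 0"
          using top[of "i - (k - s)"] g k by (cases "i < k") (auto simp: coeff_eq_0)
      qed
    qed (use k in auto)
    thus "g = 0 \<or> degree g < k - s" ..
  next
    fix f :: "'a poly"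
    assume "(\<forall>i<r. poly g (a $ i) = 0) \<and> (g = 0 \<or> degree g < k - s)" "degree f < k"
    thus "?I f g = 0"
      using g p by (subst form) (auto simp: coeff_eq_0 power_0_left intro!: sum.neutral)
  qed
  have "grl_code N s k a v A = ?cw ` {f. degree f < k}"
    by (auto simp: grl_code_def)
  \<comment> \<open>The dual places its members in the second argument of the form, so the hull is
    the radical in \<open>g\<close>.\<close>
  hence "galois_hull (N + s) p l (grl_code N s k a v A)
      = ?cw ` {g. degree g < k \<and> (\<forall>f. degree f < k \<longrightarrow> ?I f g = 0)}"
    unfolding galois_hull_def galois_dual_def using grl_codeword_carrier[OF A] by auto
  also have "{g. degree g < k \<and> (\<forall>f. degree f < k \<longrightarrow> ?I f g = 0)}
      = {g. degree g < k \<and> (\<forall>i<r. poly g (a $ i) = 0) \<and> (g = 0 \<or> degree g < k - s)}"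
    using radical by blast
  also have "\<dots> = {g. (\<Prod>i<r. [:- (a $ i), 1:]) dvd g \<and> (g = 0 \<or> degree g < k - s)}"
    using k by (auto simp: prod_linear_dvd_iff[OF inj])
  finally show ?thesis .
qed

section \<open>Top coefficients of products and powers\<close>

lemma coeff_mult_bounded_degree:
  fixes f g :: "'a::comm_semiring_1 poly"
  assumes "degree f \<le> m" "degree g \<le> n"
  shows "coeff (f * g) (m + n) = coeff f m * coeff g n"
proof -
  have "coeff (f * g) (m + n) = (\<Sum>i\<le>m + n. if i = m then coeff f m * coeff g n else 0)"
    unfolding coeff_mult
  proof (intro sum.cong refl)
    fix i assume "i \<in> {..m + n}"
    then consider "i < m" | "i = m" | "i > m" by linarith
    thus "coeff f i * coeff g (m + n - i) = (if i = m then coeff f m * coeff g n else 0)"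
      using assms by cases (auto simp: coeff_eq_0)
  qed
  thus ?thesis by simp
qed

lemma coeff_power_bounded_degree:
  fixes g :: "'a::comm_semiring_1 poly"
  assumes "degree g \<le> m"
  shows "coeff (g ^ i) (m * i) = coeff g m ^ i"
proof (induction i)
  case (Suc i)
  have "degree (g ^ i) \<le> m * i"
    using degree_power_le[of g i] mult_le_mono1[OF assms, of i] by linarith
  thus ?case
    using coeff_mult_bounded_degree[OF assms, of "g ^ i" "m * i"] Suc by simp
qed simp

text \<open>The degree is at most \<open>m * (Q + 1)\<close>, so the coefficient at \<open>n\<close>
  can be nonzero only if this bound equals \<open>n\<close>, and then it is a product of
  coefficients in degree \<open>m\<close>.\<close>

lemma coeff_mult_power_bounded_degree:
  fixes f g :: "'a::comm_semiring_1 poly"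
  assumes f: "degree f \<le> m" and g: "degree g \<le> m" and n: "m * (Q + 1) \<le> n"
  shows "degree (f * g ^ Q) \<le> n"
    and "coeff (f * g ^ Q) n = (if m * (Q + 1) = n then coeff f m * coeff g m ^ Q else 0)"
proof -
  have gQ: "degree (g ^ Q) \<le> m * Q"
    using degree_power_le[of g Q] mult_le_mono1[OF g, of Q] by linarith
  hence deg: "degree (f * g ^ Q) \<le> m * (Q + 1)"
    using degree_mult_le[of f "g ^ Q"] f by simp
  thus "degree (f * g ^ Q) \<le> n"
    using n by linarith
  show "coeff (f * g ^ Q) n = (if m * (Q + 1) = n then coeff f m * coeff g m ^ Q else 0)"
  proof (cases "m * (Q + 1) = n")
    case True
    have "coeff (f * g ^ Q) (m + m * Q) = coeff f m * coeff g m ^ Q"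
      using coeff_mult_bounded_degree[OF f gQ] coeff_power_bounded_degree[OF g] by metis
    thus ?thesis using True by simp
  next
    case False
    hence "degree (f * g ^ Q) < n"
      using deg n by linarith
    thus ?thesis using False by (simp add: coeff_eq_0)
  qed
qed

section \<open>Codes with prescribed hull dimension\<close>

lemma power_power_minus_one_factor:
  fixes Q :: nat
  assumes "Q \<ge> 2" "c > 0"
  obtains K where "(Q ^ 2) ^ c - 1 = (Q - 1) * ((Q + 1) * K)"
proof -
  \<comment> \<open>The difference of powers is factored over the integers, where subtraction is not
    truncated.\<close>
  have "int (Q ^ 2) - 1 dvd int (Q ^ 2) ^ c - 1 ^ c"
    by (metis dvd_triv_left power_diff_sumr2)
  moreover have "int (Q ^ 2) - 1 = int ((Q - 1) * (Q + 1))"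
    using assms by (simp add: of_nat_diff algebra_simps power2_eq_square)
  moreover have "int (Q ^ 2) ^ c - 1 ^ c = int ((Q ^ 2) ^ c - 1)"
    using assms by (simp add: of_nat_diff)
  ultimately have "(Q - 1) * (Q + 1) dvd (Q ^ 2) ^ c - 1"
    by (metis of_nat_dvd_iff)
  then obtain K where "(Q ^ 2) ^ c - 1 = (Q - 1) * (Q + 1) * K" ..
  thus ?thesis
    using that[of K] by (simp only: mult.assoc)
qed

theorem mainTheorem7:
  fixes p e q l t n s k h :: nat
  assumes "prime p"
    and "q = p ^ e"
    and "q > 4"
    and "CARD('a::{field,finite}) = q"
    and "l > 0"
    and "2 * l dvd e"
    and "1 \<le> t"
    and "t \<le> p ^ l - 1"
    and "n = t * ((q - 1) div (p ^ l - 1))"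
    and "s \<ge> 1"
    and "s < k"
    and "k \<le> (p ^ l + n + 1) div (p ^ l + 1)"
    and "h \<le> k - s"
  shows "\<exists>C :: 'a vec set.
    is_GRL_code (n + 1) s k C \<and>
    code_dim (n + s + 1) (galois_hull (n + s + 1) p l C) = h"
proof -
  define Q where "Q = p ^ l"
  have p: "p \<ge> 2"
    using assms(1) by (rule prime_ge_2_nat)
  have Q: "Q \<ge> 2"
    using power_increasing[of 1 l p] p assms(5) by (simp add: Q_def)
  obtain c where e: "e = 2 * l * c"
    using assms(6) by (auto simp: dvd_def)
  have q: "q = (Q ^ 2) ^ c"
    by (simp add: assms(2) Q_def e mult_ac flip: power_mult)
  have c: "c > 0"
    using assms(3) q by (intro Nat.gr0I) auto
  obtain K where K: "q - 1 = (Q - 1) * ((Q + 1) * K)"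
    unfolding q using power_power_minus_one_factor[OF Q c] .
  have n: "n = t * ((Q + 1) * K)"
  proof -
    have "(q - 1) div (Q - 1) = (Q + 1) * K"
      unfolding K using Q by (intro nonzero_mult_div_cancel_left) simp
    thus ?thesis
      by (simp only: assms(9) Q_def)
  qed
  \<comment> \<open>This leaves room to choose \<alpha> and \<omega>. It would fail for
    \<open>Q = 2\<close>, \<open>q = 4\<close>, which \<open>q > 4\<close> rules out.\<close>
  have q_gt: "Q + 1 < q - 1"
  proof (cases "Q = 2")
    case True
    have "c \<ge> 2"
      using assms(3) q True c by (cases "c = 1") auto
    hence "(Q ^ 2) ^ 2 \<le> q"
      unfolding q using Q by (intro power_increasing) auto
    thus ?thesis using True by simp
  next
    case False
    have "Q * 3 \<le> Q ^ 2"
      unfolding power2_eq_square using Q False by (intro mult_le_mono2) auto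
    also have "\<dots> \<le> q"
      unfolding q using power_increasing[of 1 c "Q ^ 2"] c Q by simp
    finally show ?thesis using Q False by linarith
  qed
  have "k * (Q + 1) \<le> Q + n + 1"
    using assms(12) by (simp add: Q_def less_eq_div_iff_mult_less_eq)
  moreover obtain k' where k': "k = Suc k'"
    using assms(11) by (cases k) auto
  \<comment> \<open>The bound on \<open>k\<close> says that \<open>f * g ^ Q\<close> has degree at
    most \<open>n\<close>, one below the number of points.\<close>
  ultimately have deg_bound: "(k - 1) * (Q + 1) \<le> n"
    by simp
  hence kn: "k \<le> n + 1"
    using le_trans[OF _ deg_bound, of "k - 1"] by simp
  have char: "CHAR('a) = p"
    using assms(1,2,4) by (intro CHAR_eq_of_CARD_prime_power) auto
  obtain S :: "'a set" and \<nu> where cardS: "card S = n + 1"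
    and \<nu>: "\<And>a. a \<in> S \<Longrightarrow> \<nu> a ^ (Q + 1) = 1 / (\<Prod>b\<in>S-{a}. a - b)"
    by (rule exists_points_with_power_weights[where 'a = 'a and Q = Q and l = l and K = K and t = t])
      (use assms char Q K n in \<open>auto simp: Q_def\<close>)
  have weight_nz: "(\<Prod>b\<in>S-{a}. a - b) \<noteq> 0" for a
    by (simp add: prod_zero_iff)
  have \<nu>_nz: "\<nu> a \<noteq> 0" if "a \<in> S" for a
    using \<nu>[OF that] weight_nz[of a] by auto
  obtain pt where pt: "bij_betw pt {..<n + 1} S"
    using ex_bij_betw_nat_finite[of S] cardS by (auto simp: lessThan_atLeast0)
  have pt_S: "pt i \<in> S" if "i < n + 1" for i
    using pt that by (auto simp: bij_betw_def)
  \<comment> \<open>Avoiding -1 keeps \<open>\<beta> j\<close> nonzero even where a 1 is added to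
    \<open>\<alpha> ^ (Q + 1)\<close>.\<close>
  obtain \<alpha> :: 'a where \<alpha>: "\<alpha> \<noteq> 0" "\<alpha> ^ (Q + 1) \<noteq> -1"
    using exists_nonzero_power_neq[of "Q + 1" "-1 :: 'a"] q_gt assms(4) by auto
  obtain \<omega> :: 'a where \<omega>: "\<omega> \<noteq> 0" "\<omega> ^ (Q + 1) \<noteq> 1"
    using exists_nonzero_power_neq[of "Q + 1" "1 :: 'a"] q_gt assms(4) by auto
  \<comment> \<open>Vanishing at \<open>r\<close> points cuts the \<open>k - s\<close> dimensions of
    low-degree polynomials down to \<open>h\<close>.\<close>
  define r where "r = k - s - h"
  define a where "a = vec (n + 1) pt"
  define v where "v = vec (n + 1) (\<lambda>i. \<nu> (pt i) * (if i < r then \<omega> else 1))"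
  define A where "A = \<alpha> \<cdot>\<^sub>m (1\<^sub>m s :: 'a mat)"
  define C where "C = grl_code (n + 1) s k a v A"
  define u where "u i = 1 / (\<Prod>b\<in>S-{pt i}. pt i - b)" for i
  \<comment> \<open>The added 1 is the contribution of the Lagrange sum. It occurs only at
    coefficient index \<open>k - 1\<close>, that is \<open>j = s - 1\<close>, and only if
    \<open>f * g ^ Q\<close> can reach degree \<open>n\<close>.\<close>
  define \<beta> where "\<beta> j = \<alpha> ^ (Q + 1) + (if j = s - 1 \<and> (k - 1) * (Q + 1) = n then 1 else 0)" for j
  have r: "r \<le> k - s" "r \<le> n + 1"
    using kn by (auto simp: r_def)
  have A: "A \<in> carrier_mat s s"
    by (simp add: A_def)
  have inj: "inj_on (\<lambda>i. a $ i) {..<n + 1}"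
    using pt by (auto simp: a_def bij_betw_def inj_on_def)
  have v_nz: "\<forall>i<n + 1. v $ i \<noteq> 0"
    using \<nu>_nz pt_S \<omega> by (auto simp: v_def)
  \<comment> \<open>The weights split into Lagrange weights, whose sum is a single coefficient, and
    a correction at the first \<open>r\<close> points.\<close>
  have v_pow: "(v $ i) ^ (Q + 1) = u i + (if i < r then (\<omega> ^ (Q + 1) - 1) * u i else 0)" if "i < n + 1" for i
  proof -
    have "(v $ i) ^ (Q + 1) = u i * (if i < r then \<omega> else 1) ^ (Q + 1)"
      using \<nu>[OF pt_S[OF that]] by (simp only: v_def index_vec[OF that] power_mult_distrib u_def)
    thus ?thesis
      by (simp add: algebra_simps)
  qed

  have form: "galois_inner p l (grl_codeword (n + 1) s k a v A f) (grl_codeword (n + 1) s k a v A g)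
      = (\<Sum>i<r. (\<omega> ^ (Q + 1) - 1) * u i * (poly f (a $ i) * poly g (a $ i) ^ (p ^ l)))
        + (\<Sum>j<s. \<beta> j * (coeff f (k - s + j) * coeff g (k - s + j) ^ (p ^ l)))"
    if fg: "degree f < k" "degree g < k" for f g
  proof -
    have deg: "degree f \<le> k - 1" "degree g \<le> k - 1"
      using fg by auto
    define X where "X i = poly f (a $ i) * poly g (a $ i) ^ Q" for i
    define Y where "Y j = coeff f (k - s + j) * coeff g (k - s + j) ^ Q" for j
    have "(\<Sum>i<n + 1. u i * X i) = (\<Sum>i<n + 1. poly (f * g ^ Q) (pt i) / (\<Prod>b\<in>S-{pt i}. pt i - b))"
      by (intro sum.cong) (auto simp: u_def X_def a_def)
    also have "\<dots> = (\<Sum>x\<in>S. poly (f * g ^ Q) x / (\<Prod>b\<in>S-{x}. x - b))"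
      by (rule sum.reindex_bij_betw[OF pt])
    also have "\<dots> = coeff (f * g ^ Q) (card S - 1)"
      using coeff_mult_power_bounded_degree(1)[OF deg deg_bound] cardS
      by (intro sum_Lagrange_weights_eq_coeff) auto
    also have "\<dots> = (if (k - 1) * (Q + 1) = n then Y (s - 1) else 0)"
      using coeff_mult_power_bounded_degree(2)[OF deg deg_bound] cardS assms(10,11)
      by (simp add: Y_def)
    also have "\<dots> = (\<Sum>j<s. if j = s - 1 then (if (k - 1) * (Q + 1) = n then Y j else 0) else 0)"
      using assms(10) by simp
    finally have main: "(\<Sum>i<n + 1. u i * X i)
      = (\<Sum>j<s. if j = s - 1 then (if (k - 1) * (Q + 1) = n then Y j else 0) else 0)" .
    have "(\<Sum>i<n + 1. (v $ i) ^ (Q + 1) * X i)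
        = (\<Sum>i<n + 1. u i * X i) + (\<Sum>i<n + 1. if i < r then (\<omega> ^ (Q + 1) - 1) * u i * X i else 0)"
      unfolding sum.distrib[symmetric] by (intro sum.cong refl, subst v_pow) (auto simp: algebra_simps)
    also have "(\<Sum>i<n + 1. if i < r then (\<omega> ^ (Q + 1) - 1) * u i * X i else 0)
        = (\<Sum>i<r. (\<omega> ^ (Q + 1) - 1) * u i * X i)"
      using r by (intro sum.mono_neutral_cong_right) auto
    finally have weighted: "(\<Sum>i<n + 1. (v $ i) ^ (Q + 1) * X i)
        = (\<Sum>i<n + 1. u i * X i) + (\<Sum>i<r. (\<omega> ^ (Q + 1) - 1) * u i * X i)" .
    have "(\<Sum>j<s. \<beta> j * Y j) = (\<Sum>i<n + 1. u i * X i) + (\<Sum>j<s. \<alpha> ^ (Q + 1) * Y j)"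
      unfolding main sum.distrib[symmetric] by (intro sum.cong refl) (auto simp: \<beta>_def ring_distribs)
    hence "(\<Sum>i<n + 1. (v $ i) ^ (Q + 1) * X i) + (\<Sum>j<s. \<alpha> ^ (Q + 1) * Y j)
        = (\<Sum>i<r. (\<omega> ^ (Q + 1) - 1) * u i * X i) + (\<Sum>j<s. \<beta> j * Y j)"
      unfolding weighted by (simp only: add_ac)
    thus ?thesis
      unfolding galois_inner_grl_codeword_scalar[OF A_def] by (simp only: X_def Y_def Q_def)
  qed

  have "galois_hull (n + 1 + s) p l C
      = grl_codeword (n + 1) s k a v A `
        {g. (\<Prod>i<r. [:- (a $ i), 1:]) dvd g \<and> (g = 0 \<or> degree g < k - s)}"
    unfolding C_def
  proof (rule galois_hull_grl_code[where \<gamma> = "\<lambda>i. (\<omega> ^ (Q + 1) - 1) * u i" and \<beta> = \<beta>])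
    show "inj_on (\<lambda>i. a $ i) {..<r}"
      using inj by (rule inj_on_subset) (use r in auto)
    show "(\<omega> ^ (Q + 1) - 1) * u i \<noteq> 0" for i
      using \<omega> weight_nz by (simp add: u_def)
    show "\<beta> j \<noteq> 0" for j
      using \<alpha> by (auto simp: \<beta>_def add_eq_0_iff2)
  qed (use A form r assms(11) p in auto)
  moreover have "linear_code (n + 1 + s) h (grl_codeword (n + 1) s k a v A `
      {g. (\<Prod>i<r. [:- (a $ i), 1:]) dvd g \<and> (g = 0 \<or> degree g < k - s)})"
  proof -
    \<comment> \<open>This rewrites the degree bound of the hull into the form degree of the divisor
      plus dimension.\<close>
    have deg: "degree (\<Prod>i<r. [:- (a $ i), 1:]) + h = k - s"
      using assms(13) by (simp add: degree_prod_eq_sum_degree r_def)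
    show ?thesis
      using linear_code_grl_multiples[OF A kn inj v_nz, of "\<Prod>i<r. [:- (a $ i), 1:]" h]
      unfolding deg by (simp add: prod_zero_iff)
  qed
  ultimately have "linear_code (n + 1 + s) h (galois_hull (n + 1 + s) p l C)"
    by simp
  hence hull: "code_dim (n + s + 1) (galois_hull (n + s + 1) p l C) = h"
    by (simp add: linear_code_def add_ac)

  have "C = grl_codeword (n + 1) s k a v A ` {g. 1 dvd g \<and> (g = 0 \<or> degree g < degree (1 :: 'a poly) + k)}"
    using assms(11) by (auto simp: C_def grl_code_def)
  hence "linear_code (n + 1 + s) k C"
    using linear_code_grl_multiples[OF A kn inj v_nz, of 1 k] by simp
  moreover have "invertible_mat A"
  proof -
    have "inverts_mat A (inverse \<alpha> \<cdot>\<^sub>m 1\<^sub>m s)" "inverts_mat (inverse \<alpha> \<cdot>\<^sub>m 1\<^sub>m s) A"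
      using \<alpha>(1) by (auto simp: inverts_mat_def A_def intro!: eq_matI)
    thus ?thesis
      by (auto simp: invertible_mat_def A_def)
  qed
  moreover have "a \<in> carrier_vec (n + 1)" "v \<in> carrier_vec (n + 1)"
    by (simp_all add: a_def v_def)
  ultimately have "is_GRL_code (n + 1) s k C"
    unfolding is_GRL_code_def using assms(10,11) kn inj v_nz A C_def
    by (intro conjI exI[of _ a] exI[of _ v] exI[of _ A]) simp_all
  thus ?thesis
    using hull by blast
qed

end
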